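(* For every integer $d\ge 2$ and every $0$-symmetric convex body $\mathbf{K}$ in $\mathbb{R}^d$ one has $$\frac{d^{3/2}}{\sqrt{2\pi e}\ \mathrm{ovr}(\mathbf{K})}\ \leq\ \frac{d}{\left(\mathrm{vol}(\mathbf{B}_2^d)\right)^{1/d}\ \mathrm{ovr}(\mathbf{K})}\ \leq\ \mathrm{vein}(\mathbf{K}),$$ where $\mathbf{B}_2^d$ is the Euclidean unit ball in $\mathbb{R}^d$.
   Context: A convex body in $\mathbb{R}^d$ is a compact convex set with non-empty interior; it is $0$-symmetric if it is symmetric about the origin $0$. $\mathrm{vol}(\cdot)$ denotes the volume in $\mathbb{R}^d$. For a $0$-symmetric convex body $\mathbf{K}\subset\mathbb{R}^d$, $d\ge 2$, let $\|x\|_{\mathbf{K}}=\inf\{\lambda>0 : x\in\lambda\mathbf{K}\}$ be the norm with unit ball $\mathbf{K}$. The vertex index of $\mathbf{K}$ is $$\mathrm{vein}(\mathbf{K})=\inf\Big\{\sum_i\|p_i\|_{\mathbf{K}} : \mathbf{K}\subset\mathrm{conv}\{p_i\}\Big\},$$ where the infimum is over all finite families of points $p_1,\dots,p_n\in\mathbb{R}^d$ whose convex hull contains $\mathbf{K}$. The outer volume ratio of $\mathbf{K}$ is $$\mathrm{ovr}(\mathbf{K})=\inf\left(\frac{\mathrm{vol}(\mathcal{E})}{\mathrm{vol}(\mathbf{K})}\right)^{1/d},$$ where the infimum is taken over all $0$-symmetric ellipsoids $\mathcal{E}$ in $\mathbb{R}^d$ containing $\mathbf{K}$. *)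

theory Defs
  imports "HOL-Analysis.Analysis"
begin

abbreviation vol :: "(real ^ 'n) set \<Rightarrow> real" where
  "vol \<equiv> measure lebesgue"

definition convex_body :: "(real ^ 'n) set \<Rightarrow> bool" where
  "convex_body K \<longleftrightarrow> compact K \<and> convex K \<and> interior K \<noteq> {}"

definition zero_symmetric :: "(real ^ 'n) set \<Rightarrow> bool" where
  "zero_symmetric K \<longleftrightarrow> uminus ` K = K"

definition body_norm :: "(real ^ 'n) set \<Rightarrow> real ^ 'n \<Rightarrow> real" where
  "body_norm K x = Inf {l. l > 0 \<and> x \<in> (\<lambda>y. l *\<^sub>R y) ` K}"

text \<open>The points form a family rather than a set: repetitions are allowed and are
  counted in the sum.\<close>

definition vein :: "(real ^ 'n) set \<Rightarrow> real" where
  "vein K = Inf {(\<Sum>i<m. body_norm K (p i)) | (m :: nat) (p :: nat \<Rightarrow> real ^ 'n).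
                   K \<subseteq> convex hull (p ` {..<m})}"

text \<open>Ellipsoids are non-degenerate and solid: bijective linear images of the closed
  Euclidean unit ball. Linearity, as opposed to affinity, places the centre at the origin.\<close>

definition zero_symmetric_ellipsoid :: "(real ^ 'n) set \<Rightarrow> bool" where
  "zero_symmetric_ellipsoid E \<longleftrightarrow>
     (\<exists>f :: real ^ 'n \<Rightarrow> real ^ 'n. linear f \<and> bij f \<and> E = f ` cball 0 1)"

definition ovr :: "(real ^ 'n) set \<Rightarrow> real" where
  "ovr K = Inf {(vol E / vol K) powr (1 / real CARD('n)) | E.
                  zero_symmetric_ellipsoid E \<and> K \<subseteq> E}"

end

theory Submission
  imports Defs
begin

text \<open>
  Write \<open>B\<close> for the Euclidean unit ball and let \<open>f B \<supseteq> K\<close> be an ellipsoid, \<open>K \<subseteq> conv {p\<^sub>i}\<close> and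
  \<open>q\<^sub>i = f\<^sup>-\<^sup>1 p\<^sub>i\<close>, so that the Euclidean norm of \<open>q\<^sub>i\<close> is at most the \<open>K\<close>-norm of \<open>p\<^sub>i\<close>. By
  the conic form of Caratheodory's theorem, \<open>conv {q\<^sub>i}\<close> is covered, up to a null set, by the simplices spanned by \<open>0\<close>
  and \<open>d\<close> of the points. Hadamard's inequality bounds each volume by the product of the norms
  divided by \<open>d!\<close>, and these products sum to at most \<open>S\<^sup>d / d!\<close>, where \<open>S\<close> is the sum of all the
  norms. Hence \<open>vol (f\<^sup>-\<^sup>1 K) \<le> S\<^sup>d / (d!)\<^sup>2\<close>, and an estimate of the Gamma function gives
  \<open>d\<^sup>d / (d!)\<^sup>2 \<le> vol(B)\<^sup>2\<close>, which is what is needed; no volume bound for polar bodies enters.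
\<close>

section \<open>Volumes of simplices and Hadamard's inequality\<close>

text \<open>The library version, \<open>measure_linear_image\<close>, demands a well-ordered index type.\<close>

lemma
  fixes f :: "real ^ 'n \<Rightarrow> real ^ 'n"
  assumes "linear f" and "S \<in> lmeasurable"
  shows lmeasurable_linear_image_cart: "f ` S \<in> lmeasurable"
    and measure_linear_image_cart:
      "measure lebesgue (f ` S) = \<bar>det (matrix f)\<bar> * measure lebesgue S"
proof -
  define good where "good g \<longleftrightarrow> (\<forall>S \<in> lmeasurable. g ` S \<in> lmeasurable \<and>
      measure lebesgue (g ` S) = \<bar>det (matrix g)\<bar> * measure lebesgue S)"
    for g :: "real ^ 'n \<Rightarrow> real ^ 'n"
  \<comment> \<open>For determinant 1 or -1 it is enough that volumes of boxes are preserved;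
    coordinate swaps and shears are reduced to this.\<close>
  have boxes: "good g" if "linear g" and "\<bar>det (matrix g)\<bar> = 1"
    and "\<And>a b. measure lebesgue (g ` cbox a b) = measure lebesgue (cbox a b)" for g
    unfolding good_def
  proof
    fix S :: "(real ^ 'n) set"
    assume "S \<in> lmeasurable"
    from measure_linear_sufficient[OF that(1) this, of 1] that(2,3)
    show "g ` S \<in> lmeasurable \<and>
        measure lebesgue (g ` S) = \<bar>det (matrix g)\<bar> * measure lebesgue S"
      by simp
  qed
  have "good f"
    using \<open>linear f\<close>
  proof (rule induct_linear_elementary)
    fix g h :: "real ^ 'n \<Rightarrow> real ^ 'n"
    assume lin: "linear g" "linear h" and g: "good g" and h: "good h"
    show "good (g \<circ> h)"
      unfolding good_def
    proof
      fix S :: "(real ^ 'n) set"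
      assume "S \<in> lmeasurable"
      then have "h ` S \<in> lmeasurable" "g ` h ` S \<in> lmeasurable"
        "measure lebesgue (g ` h ` S) = \<bar>det (matrix g)\<bar> * (\<bar>det (matrix h)\<bar> * measure lebesgue S)"
        using g h by (auto simp: good_def)
      then show "(g \<circ> h) ` S \<in> lmeasurable \<and>
          measure lebesgue ((g \<circ> h) ` S) = \<bar>det (matrix (g \<circ> h))\<bar> * measure lebesgue S"
        by (simp add: image_comp matrix_compose lin det_mul abs_mult)
    qed
  next
    fix g :: "real ^ 'n \<Rightarrow> real ^ 'n" and i
    assume g: "linear g" and 0: "\<And>x. g x $ i = 0"
    \<comment> \<open>A map that kills coordinate \<open>i\<close> misses \<open>axis i 1\<close>,
      so it is singular and both sides of the volume formula vanish.\<close>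
    then have "g x \<noteq> axis i 1" for x
      by (metis axis_nth zero_neq_one)
    then have "\<not> surj g"
      unfolding surj_def by metis
    then have ninj: "\<not> inj g"
      using g linear_injective_imp_surjective by blast
    then have "negligible (g ` S)" for S
      using g negligible_linear_singular_image by blast
    moreover have "det (matrix g) = 0"
      using ninj det_nz_iff_inj[OF g] by blast
    ultimately show "good g"
      by (simp add: good_def negligible_iff_measure)
  next
    fix c :: "'n \<Rightarrow> real"
    have "det (matrix (\<lambda>x. \<chi> i. c i * x $ i)) = prod c UNIV"
      by (subst det_diagonal) (auto simp: matrix_def axis_def)
    then show "good (\<lambda>x. \<chi> i. c i * x $ i)"
      by (simp add: good_def measurable_stretch measure_stretch)
  next
    fix m n :: 'n
    assume "m \<noteq> n"
    let ?t = "Transposition.transpose m n"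
    let ?h = "\<lambda>x :: real ^ 'n. \<chi> i. x $ ?t i"
    have lin: "linear ?h"
      by (rule linearI) (simp_all add: vec_eq_iff)
    have mat: "matrix ?h = (\<chi> i. mat 1 $ ?t i)"
      by (simp add: matrix_def mat_def axis_def vec_eq_iff)
    have det: "\<bar>det (matrix ?h)\<bar> = 1"
      unfolding mat
      by (subst det_permute_rows) (auto simp: permutes_swap_id sign_swap_id abs_mult)
    have img: "?h ` cbox a b = cbox (?h a) (?h b)" for a b
    proof (intro equalityI subsetI)
      fix x
      assume x: "x \<in> cbox (?h a) (?h b)"
      have "a $ i \<le> x $ ?t i \<and> x $ ?t i \<le> b $ i" for i
        using x[unfolded mem_box_cart, rule_format, of "?t i"] by simp
      then have "?h x \<in> cbox a b"
        by (simp add: mem_box_cart)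
      moreover have "x = ?h (?h x)"
        by (simp add: vec_eq_iff)
      ultimately show "x \<in> ?h ` cbox a b"
        by blast
    qed (auto simp: mem_box_cart)
    have "measure lebesgue (?h ` cbox a b) = measure lebesgue (cbox a b)" for a b
    proof (cases "cbox a b = {}")
      case False
      then have "cbox (?h a) (?h b) \<noteq> {}"
        using img by blast
      then show ?thesis
        using False prod.permute[OF permutes_swap_id, of m UNIV n "\<lambda>i. b $ i - a $ i", symmetric]
        by (simp add: img content_cbox_cart o_def)
    qed simp
    then show "good ?h"
      by (rule boxes[OF lin det])
  next
    fix m n :: 'n
    assume mn: "m \<noteq> n"
    let ?h = "\<lambda>x :: real ^ 'n. \<chi> i. if i = m then x $ m + x $ n else x $ i"
    have lin: "linear ?h"
      by (rule linearI) (auto simp: vec_eq_iff algebra_simps)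
    have "matrix ?h = (\<chi> k. if k = m then row m (mat 1) + 1 *s row n (mat 1) else row k (mat 1))"
      by (auto simp: matrix_def mat_def axis_def row_def vec_eq_iff)
    then have det: "\<bar>det (matrix ?h)\<bar> = 1"
      by (simp only: det_row_operation[OF mn] det_I abs_one)
    have "measure lebesgue (?h ` cbox a b) = measure lebesgue (cbox a b)" for a b
    proof (cases "cbox a b = {}")
      case False
      \<comment> \<open>The shear rule for boxes asks for a nonnegative lower bound in coordinate
        \<open>n\<close>; moving the lower corner to the origin provides it, and translations
        preserve volume.\<close>
      have box: "cbox a b = (+) a ` cbox 0 (b - a)"
        using cbox_translation[of a 0 "b - a"] by simp
      have "?h ` cbox a b = (+) (?h a) ` ?h ` cbox 0 (b - a)"
        unfolding box image_image using linear_add[OF lin] by (intro image_cong) auto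
      then have "measure lebesgue (?h ` cbox a b) = measure lebesgue (?h ` cbox 0 (b - a))"
        by (simp only: measure_translation)
      also have "\<dots> = measure lebesgue (cbox 0 (b - a))"
        using False box by (intro measure_shear_interval mn) auto
      also have "\<dots> = measure lebesgue (cbox a b)"
        by (simp only: box measure_translation)
      finally show ?thesis .
    qed simp
    then show "good ?h"
      by (rule boxes[OF lin det])
  qed
  with assms show "f ` S \<in> lmeasurable"
    and "measure lebesgue (f ` S) = \<bar>det (matrix f)\<bar> * measure lebesgue S"
    by (auto simp: good_def)
qed

text \<open>Gram-Schmidt, one row at a time: replacing a row by its component orthogonal to the span
  of all other rows keeps the determinant and does not increase the norm. Once every row is treated,
  the rows are pairwise orthogonal and equality holds.\<close>

theorem hadamard_inequality:
  fixes A :: "real ^ 'n ^ 'n"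
  shows "\<bar>det A\<bar> \<le> (\<Prod>i\<in>UNIV. norm (row i A))"
proof -
  have "\<exists>B. det B = det A \<and> (\<forall>i. norm (row i B) \<le> norm (row i A)) \<and>
          (\<forall>i\<in>F. \<forall>j. j \<noteq> i \<longrightarrow> orthogonal (row i B) (row j B))" if "finite F" for F :: "'n set"
    using that
  proof (induction F)
    case (insert i F)
    then obtain B where B: "det B = det A" "\<And>k. norm (row k B) \<le> norm (row k A)"
      "\<And>k j. k \<in> F \<Longrightarrow> j \<noteq> k \<Longrightarrow> orthogonal (row k B) (row j B)"
      by blast
    let ?R = "{row j B | j. j \<noteq> i}"
    obtain y z where y: "y \<in> span ?R" and z: "\<And>w. w \<in> span ?R \<Longrightarrow> orthogonal z w"
      and eq: "row i B = y + z"
      using orthogonal_subspace_decomp_exists by blast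
    \<comment> \<open>Row \<open>i\<close> becomes \<open>z\<close>; it is written as a sum with
      \<open>- y\<close> to fit the determinant rule for adding a vector from the span of the other
      rows.\<close>
    define B' where "B' = (\<chi> k. if k = i then row i B + (- y) else row k B)"
    have row: "row k B' = (if k = i then z else row k B)" for k
      by (simp add: B'_def row_def vec_eq_iff eq[unfolded row_def vec_eq_iff, simplified])
    have "- y \<in> vec.span ?R"
      using span_neg[OF y] by (simp add: span_vec_eq)
    then have "det B' = det A"
      using det_row_span[where x = "- y" and i = i and A = B] B(1) by (simp add: B'_def)
    moreover have "norm z \<le> norm (row i B)"
    proof -
      have "(norm (row i B))\<^sup>2 = (norm y)\<^sup>2 + (norm z)\<^sup>2"
        unfolding eq using z[OF y] by (intro norm_add_Pythagorean) (simp add: orthogonal_commute)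
      then show ?thesis
        by (simp add: power2_le_imp_le)
    qed
    then have "norm (row k B') \<le> norm (row k A)" for k
      using B(2)[of k] by (auto simp: row)
    moreover have "orthogonal z (row j B)" if "j \<noteq> i" for j
      using that by (intro z span_base) auto
    then have "orthogonal (row k B') (row j B')" if "k \<in> insert i F" "j \<noteq> k" for k j
      using that B(3)[of k j] by (auto simp: row orthogonal_commute)
    ultimately show ?case
      by blast
  next
    case empty
    show ?case
      by (intro exI[of _ A]) simp
  qed
  from this[of UNIV] obtain B where B: "det B = det A" "\<And>i. norm (row i B) \<le> norm (row i A)"
    "\<And>i j. j \<noteq> i \<Longrightarrow> orthogonal (row i B) (row j B)"
    by auto
  \<comment> \<open>The Gram matrix of orthogonal rows is diagonal, so the square of
    \<open>det B\<close> is the product of the squared norms.\<close>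
  have gram: "(B ** Finite_Cartesian_Product.transpose B) $ i $ j = row i B \<bullet> row j B" for i j
    by (simp add: matrix_matrix_mult_def Finite_Cartesian_Product.transpose_def row_def inner_vec_def)
  have "(det B)\<^sup>2 = det (B ** Finite_Cartesian_Product.transpose B)"
    by (simp add: det_mul power2_eq_square)
  also have "\<dots> = (\<Prod>i\<in>UNIV. (B ** Finite_Cartesian_Product.transpose B) $ i $ i)"
    using B(3) by (intro det_diagonal) (auto simp: gram orthogonal_def)
  also have "\<dots> = (\<Prod>i\<in>UNIV. norm (row i B))\<^sup>2"
    by (simp add: gram dot_square_norm prod_power_distrib)
  finally have "\<bar>det B\<bar> = \<bar>\<Prod>i\<in>UNIV. norm (row i B)\<bar>"
    by (simp add: power2_eq_iff abs_eq_iff)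
  then have "\<bar>det A\<bar> = (\<Prod>i\<in>UNIV. norm (row i B))"
    using B(1) by (simp add: abs_of_nonneg prod_nonneg)
  also have "\<dots> \<le> (\<Prod>i\<in>UNIV. norm (row i A))"
    by (intro prod_mono) (simp add: B(2))
  finally show ?thesis .
qed

text \<open>The matrix whose columns are the points of \<open>I\<close> maps the standard simplex,
  of volume \<open>1 / fact CARD('n)\<close>, onto this hull. Hadamard's inequality bounds its
  determinant.\<close>

lemma measure_simplex_origin_le:
  fixes I :: "(real ^ 'n) set"
  assumes I: "card I = CARD('n)"
  shows "measure lebesgue (convex hull (insert 0 I)) \<le> (\<Prod>v\<in>I. norm v) / fact CARD('n)"
proof -
  have "finite I"
    using I by (intro card_ge_0_finite) simp
  then obtain g :: "'n \<Rightarrow> real ^ 'n" where g: "bij_betw g UNIV I"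
    using finite_same_card_bij[of "UNIV :: 'n set" I] I by auto
  define M where "M = (\<chi> i j. g j $ i)"
  let ?std = "convex hull (insert 0 Basis) :: (real ^ 'n) set"
  have col: "M *v axis i 1 = g i" for i
    by (simp add: M_def matrix_vector_mult_basis column_def vec_eq_iff)
  have "(*v) M ` Basis = I"
    using g by (auto simp: Basis_vec_def col bij_betw_def image_iff)
  then have img: "(*v) M ` ?std = convex hull (insert 0 I)"
    by (simp add: convex_hull_linear_image)
  have cpt: "compact ?std"
    by (intro finite_imp_compact_convex_hull) auto
  then have "measure lebesgue ?std = 1 / fact CARD('n)"
    using content_std_simplex[where 'a = "real ^ 'n"]
    by (subst measure_completion) (auto dest: compact_imp_closed)
  then have "measure lebesgue (convex hull (insert 0 I)) = \<bar>det M\<bar> / fact CARD('n)"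
    using measure_linear_image_cart[of "(*v) M" ?std] lmeasurable_compact[OF cpt]
    by (simp add: img)
  moreover have "\<bar>det M\<bar> \<le> (\<Prod>v\<in>I. norm v)"
  proof -
    have "\<bar>det M\<bar> \<le> (\<Prod>i\<in>UNIV. norm (row i (Finite_Cartesian_Product.transpose M)))"
      using hadamard_inequality[of "Finite_Cartesian_Product.transpose M"] by simp
    also have "\<dots> = (\<Prod>i\<in>UNIV. norm (g i))"
      by (simp add: M_def column_def)
    also have "\<dots> = (\<Prod>v\<in>I. norm v)"
      using g by (rule prod.reindex_bij_betw)
    finally show ?thesis .
  qed
  ultimately show ?thesis
    by (simp add: divide_right_mono)
qed

section \<open>Volume of the convex hull of finitely many points\<close>

text \<open>The left side is the elementary symmetric polynomial of degree \<open>k\<close>.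
  Splitting by membership of \<open>x\<close> gives its recursion, and the resulting two terms are
  part of the binomial expansion of \<open>(a x + sum a A) ^ k\<close>.\<close>

lemma sum_prod_subsets_le:
  fixes a :: "'a \<Rightarrow> real"
  assumes "finite A" and "\<And>x. x \<in> A \<Longrightarrow> a x \<ge> 0"
  shows "(\<Sum>I | I \<subseteq> A \<and> card I = k. prod a I) \<le> sum a A ^ k / fact k"
  using assms
proof (induction A arbitrary: k)
  case empty
  have "{I. I \<subseteq> {} \<and> card I = k} = (if k = 0 then {{}} else ({} :: 'a set set))"
    by auto
  then show ?case
    by (simp add: power_0_left)
next
  case (insert x A)
  show ?case
  proof (cases k)
    case 0
    have "{I. I \<subseteq> insert x A \<and> card I = 0} = {{}}"
      using insert.hyps by (auto dest: finite_subset)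
    then show ?thesis
      using 0 by simp
  next
    case (Suc m)
    let ?P = "\<lambda>k. {I. I \<subseteq> A \<and> card I = k}"
    have fin: "finite J" if "J \<subseteq> A" for J
      using that insert.hyps finite_subset by blast
    have split: "{I. I \<subseteq> insert x A \<and> card I = Suc m} = ?P (Suc m) \<union> insert x ` ?P m"
    proof (intro equalityI subsetI)
      fix I
      assume I: "I \<in> {I. I \<subseteq> insert x A \<and> card I = Suc m}"
      show "I \<in> ?P (Suc m) \<union> insert x ` ?P m"
      proof (cases "x \<in> I")
        case True
        then have "I = insert x (I - {x})" "I - {x} \<in> ?P m"
          using I by auto
        then show ?thesis
          by blast
      qed (use I in auto)
    qed (use insert.hyps fin in \<open>auto simp: card_insert_if\<close>)
    have inj: "inj_on (insert x) (?P m)"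
    proof (rule inj_onI)
      fix I J
      assume "I \<in> ?P m" "J \<in> ?P m" "insert x I = insert x J"
      moreover from this have "x \<notin> I" "x \<notin> J"
        using insert.hyps by auto
      ultimately show "I = J"
        by (simp add: insert_ident)
    qed
    have finP: "finite (?P k)" for k
      using insert.hyps by simp
    have "(\<Sum>I | I \<subseteq> insert x A \<and> card I = Suc m. prod a I)
        = (\<Sum>I\<in>?P (Suc m). prod a I) + (\<Sum>I\<in>insert x ` ?P m. prod a I)"
      unfolding split using insert.hyps finP by (intro sum.union_disjoint) auto
    also have "(\<Sum>I\<in>insert x ` ?P m. prod a I) = (\<Sum>I\<in>?P m. a x * prod a I)"
      unfolding sum.reindex[OF inj] o_def
      using insert.hyps fin by (intro sum.cong refl prod.insert) auto
    also have "\<dots> = a x * (\<Sum>I\<in>?P m. prod a I)"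
      by (simp add: sum_distrib_left)
    also have "(\<Sum>I\<in>?P (Suc m). prod a I) + a x * (\<Sum>I\<in>?P m. prod a I)
        \<le> sum a A ^ Suc m / fact (Suc m) + a x * (sum a A ^ m / fact m)"
      using insert.prems by (intro add_mono mult_left_mono insert.IH) auto
    also have "a x * (sum a A ^ m / fact m) = of_nat (Suc m) * a x * sum a A ^ m / fact (Suc m)"
      by (simp add: divide_simps del: of_nat_Suc)
    also have "sum a A ^ Suc m / fact (Suc m) + \<dots>
        = (sum a A ^ Suc m + of_nat (Suc m) * a x * sum a A ^ m) / fact (Suc m)"
      by (rule add_divide_distrib [symmetric])
    also have "\<dots> \<le> (a x + sum a A) ^ Suc m / fact (Suc m)"
    proof (rule divide_right_mono)
      \<comment> \<open>Only the terms of degree 0 and 1 in \<open>a x\<close> are kept; the others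
        are nonnegative.\<close>
      have "(\<Sum>k\<in>{0, 1}. of_nat (Suc m choose k) * a x ^ k * sum a A ^ (Suc m - k))
          \<le> (\<Sum>k\<le>Suc m. of_nat (Suc m choose k) * a x ^ k * sum a A ^ (Suc m - k))"
        using insert.prems
        by (intro sum_mono2) (auto intro!: mult_nonneg_nonneg zero_le_power sum_nonneg)
      then show "sum a A ^ Suc m + of_nat (Suc m) * a x * sum a A ^ m \<le> (a x + sum a A) ^ Suc m"
        unfolding binomial_ring by simp
    qed simp
    finally show ?thesis
      using insert.hyps Suc by simp
  qed
qed

text \<open>Among representations of \<open>x\<close> with nonnegative weights of total at most 1,
  take one with the fewest points. A linear relation between these points could be subtracted until
  some weight vanishes, against minimality; the vertex \<open>0\<close> absorbs the missing
  weight.\<close>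

lemma convex_hull_subset_independent_simplices:
  fixes P :: "'a :: euclidean_space set"
  assumes P: "finite P" and x: "x \<in> convex hull P"
  obtains I where "I \<subseteq> P" "independent I" "x \<in> convex hull (insert 0 I)"
proof -
  define rep where "rep I \<longleftrightarrow> I \<subseteq> P \<and> (\<exists>w. (\<forall>v\<in>I. 0 \<le> w v) \<and> sum w I \<le> 1 \<and> (\<Sum>v\<in>I. w v *\<^sub>R v) = x)"
    for I
  have "rep P"
    using x P by (auto simp: rep_def convex_hull_finite)
  then obtain I where I: "rep I" and min: "\<And>J. rep J \<Longrightarrow> card I \<le> card J"
    using ex_has_least_nat[of rep P card] by blast
  obtain w where w: "\<And>v. v \<in> I \<Longrightarrow> 0 \<le> w v" "sum w I \<le> 1" "(\<Sum>v\<in>I. w v *\<^sub>R v) = x" and IP: "I \<subseteq> P"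
    using I by (auto simp: rep_def)
  have fin: "finite I"
    using IP P finite_subset by blast
  have "independent I"
  proof
    assume "dependent I"
    then obtain c0 where c0: "(\<Sum>v\<in>I. c0 v *\<^sub>R v) = 0" "\<exists>v\<in>I. c0 v \<noteq> 0"
      using fin by (auto simp: dependent_finite)
    text \<open>After a sign change the relation can be subtracted without increasing the total weight.\<close>
    obtain c where c: "(\<Sum>v\<in>I. c v *\<^sub>R v) = 0" "sum c I \<ge> 0" and pos: "\<exists>v\<in>I. c v > 0"
    proof -
      define c where "c = (if sum c0 I > 0 \<or> sum c0 I = 0 then c0 else - c0)"
      have 1: "(\<Sum>v\<in>I. c v *\<^sub>R v) = 0" "sum c I \<ge> 0" "\<exists>v\<in>I. c v \<noteq> 0"
        using c0 by (auto simp: c_def sum_negf)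
      \<comment> \<open>If no coefficient were positive, the nonnegative total would force all of
        them to be zero.\<close>
      moreover have "\<exists>v\<in>I. c v > 0"
      proof (rule ccontr)
        assume neg: "\<not> ?thesis"
        then have "sum (\<lambda>v. - c v) I = 0"
          using 1(2) sum_nonneg[of I "\<lambda>v. - c v"] by (force simp: sum_negf not_less)
        then have "\<forall>v\<in>I. - c v = 0"
          using neg fin by (subst (asm) sum_nonneg_eq_0_iff) (auto simp: not_less)
        with 1(3) show False
          by simp
      qed
      ultimately show ?thesis
        using that by blast
    qed
    define Q where "Q = {v \<in> I. c v > 0}"
    have Q: "finite Q" "Q \<noteq> {}"
      using fin pos by (auto simp: Q_def)
    \<comment> \<open>The largest multiple of \<open>c\<close> that leaves all weights nonnegative;
      the weight of a point \<open>u\<close> attaining the minimum becomes zero.\<close>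
    define t where "t = Min ((\<lambda>v. w v / c v) ` Q)"
    have "t \<in> (\<lambda>v. w v / c v) ` Q"
      unfolding t_def using Q by (intro Min_in) auto
    then obtain u where u: "u \<in> I" "c u > 0" "t = w u / c u"
      by (auto simp: Q_def)
    have t0: "t \<ge> 0"
      using u w(1) by simp
    have tle: "t * c v \<le> w v" if "v \<in> I" for v
    proof (cases "c v > 0")
      case True
      then have "t \<le> w v / c v"
        unfolding t_def using that Q by (intro Min_le) (auto simp: Q_def)
      with True show ?thesis
        by (simp add: field_simps)
    next
      case False
      then have "t * c v \<le> 0"
        using t0 by (simp add: mult_nonneg_nonpos)
      then show ?thesis
        using w(1)[OF that] by linarith
    qed
    have "(\<Sum>v\<in>I. (w v - t * c v) *\<^sub>R v) = (\<Sum>v\<in>I. w v *\<^sub>R v) - t *\<^sub>R (\<Sum>v\<in>I. c v *\<^sub>R v)"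
      by (simp add: scaleR_left_diff_distrib sum_subtractf scaleR_right.sum)
    then have "(\<Sum>v\<in>I. (w v - t * c v) *\<^sub>R v) = x"
      using w(3) c(1) by simp
    moreover have "(\<Sum>v\<in>I. w v - t * c v) \<le> 1"
      using w(2) mult_nonneg_nonneg[OF t0 c(2)]
      by (simp add: sum_subtractf flip: sum_distrib_left)
    moreover have "w u - t * c u = 0"
      using u by simp
    ultimately have "rep (I - {u})"
      unfolding rep_def using IP tle u(1) fin
      by (intro conjI exI[of _ "\<lambda>v. w v - t * c v"]) (auto simp: sum_diff1)
    then show False
      using min[of "I - {u}"] card_Diff1_less[OF fin u(1)] by simp
  qed
  moreover have "x \<in> convex hull (insert 0 I)"
  proof -
    have 0: "0 \<notin> I"
      using \<open>independent I\<close> dependent_zero by blast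
    define w' where "w' v = (if v = 0 then 1 - sum w I else w v)" for v
    have "w' v = w v" if "v \<in> I" for v
      using that 0 by (auto simp: w'_def)
    then have s: "(\<Sum>v\<in>I. w' v) = sum w I" "(\<Sum>v\<in>I. w' v *\<^sub>R v) = x"
      using w(3) by simp_all
    have "sum w' (insert 0 I) = 1" "(\<Sum>v\<in>insert 0 I. w' v *\<^sub>R v) = x"
      using 0 fin s by (simp_all add: w'_def)
    moreover have "\<forall>v\<in>insert 0 I. 0 \<le> w' v"
      using w by (auto simp: w'_def)
    ultimately show ?thesis
      using fin by (auto simp: convex_hull_finite)
  qed
  ultimately show ?thesis
    using that IP by blast
qed

text \<open>Simplices with fewer than \<open>CARD('n)\<close> nonzero vertices lie in proper
  subspaces and are null. One factorial comes from the volume of each remaining simplex, the other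
  from summing the products over subsets.\<close>

theorem measure_convex_hull_le:
  fixes P :: "(real ^ 'n) set"
  assumes P: "finite P"
  shows "measure lebesgue (convex hull P) \<le> (\<Sum>v\<in>P. norm v) ^ CARD('n) / (fact CARD('n))\<^sup>2"
proof -
  let ?n = "CARD('n)"
  let ?hull = "\<lambda>I :: (real ^ 'n) set. convex hull (insert 0 I)"
  define \<I> where "\<I> = {I. I \<subseteq> P \<and> independent I}"
  have finI: "finite I" if "I \<subseteq> P" for I
    using that P finite_subset by blast
  have fin: "finite \<I>"
    using P by (simp add: \<I>_def)
  have meas: "?hull I \<in> lmeasurable" if "I \<subseteq> P" for I
    using finI[OF that] by (intro lmeasurable_compact finite_imp_compact_convex_hull) auto
  have simplex: "measure lebesgue (?hull I) \<le> (if card I = ?n then (\<Prod>v\<in>I. norm v) / fact ?n else 0)"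
    if "I \<in> \<I>" for I
  proof (cases "card I = ?n")
    case False
    have "card I \<le> ?n"
      using that independent_bound[of I] by (auto simp: \<I>_def)
    moreover have "dim (?hull I) \<le> card I"
      using convex_hull_subset_span[of "insert 0 I"] that finI
      by (intro dim_le_card) (auto simp: \<I>_def)
    ultimately have "dim (?hull I) < DIM(real ^ 'n)"
      using False by simp
    then have "negligible (?hull I)"
      by (rule negligible_lowdim)
    then show ?thesis
      using False by (simp add: negligible_imp_measure0)
  qed (simp add: measure_simplex_origin_le)
  have "convex hull P \<subseteq> (\<Union>I\<in>\<I>. ?hull I)"
  proof
    fix x
    assume "x \<in> convex hull P"
    with P obtain I where "I \<subseteq> P" "independent I" "x \<in> ?hull I"
      by (rule convex_hull_subset_independent_simplices)
    then show "x \<in> (\<Union>I\<in>\<I>. ?hull I)"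
      by (auto simp: \<I>_def)
  qed
  then have "measure lebesgue (convex hull P) \<le> measure lebesgue (\<Union>I\<in>\<I>. ?hull I)"
  proof (rule measure_mono_fmeasurable)
    show "convex hull P \<in> sets lebesgue"
      using P by (intro fmeasurableD lmeasurable_compact finite_imp_compact_convex_hull)
    show "(\<Union>I\<in>\<I>. ?hull I) \<in> lmeasurable"
      using fin meas by (intro fmeasurable.finite_UN) (auto simp: \<I>_def)
  qed
  also have "\<dots> \<le> (\<Sum>I\<in>\<I>. measure lebesgue (?hull I))"
    using fin meas by (intro measure_UNION_le) (auto simp: \<I>_def intro!: fmeasurableD)
  also have "\<dots> \<le> (\<Sum>I\<in>\<I>. if card I = ?n then (\<Prod>v\<in>I. norm v) / fact ?n else 0)"
    by (intro sum_mono simplex)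
  also have "\<dots> = (\<Sum>I | I \<in> \<I> \<and> card I = ?n. (\<Prod>v\<in>I. norm v) / fact ?n)"
    using fin by (simp add: sum.inter_filter)
  also have "\<dots> \<le> (\<Sum>I | I \<subseteq> P \<and> card I = ?n. (\<Prod>v\<in>I. norm v) / fact ?n)"
    using P by (intro sum_mono2) (auto simp: \<I>_def prod_nonneg)
  also have "\<dots> = (\<Sum>I | I \<subseteq> P \<and> card I = ?n. \<Prod>v\<in>I. norm v) / fact ?n"
    by (simp add: sum_divide_distrib)
  also have "\<dots> \<le> ((\<Sum>v\<in>P. norm v) ^ ?n / fact ?n) / fact ?n"
    using P by (intro divide_right_mono sum_prod_subsets_le) auto
  finally show ?thesis
    by (simp add: power2_eq_square)
qed

section \<open>Estimates of the volume of the unit ball\<close>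

text \<open>A form of the bound of \<open>(1 + 1 / x) powr x\<close> by \<open>exp 1\<close>,
  arranged as one step of an induction alongside the recurrence of \<open>Gamma\<close>.\<close>

lemma powr_self_step:
  fixes x :: real
  assumes "x > 0"
  shows "(x + 1) powr (x + 1) \<le> exp 1 * (x + 1) * x powr x"
proof -
  have "x * ln (1 + 1 / x) \<le> x * (1 / x)"
    using assms by (intro mult_left_mono ln_add_one_self_le_self) auto
  then have "(1 + 1 / x) powr x \<le> exp 1"
    using assms by (simp add: powr_def)
  moreover have "(x + 1) powr x = x powr x * (1 + 1 / x) powr x"
    using assms by (simp add: ring_distribs flip: powr_mult)
  ultimately have "(x + 1) powr x \<le> x powr x * exp 1"
    by (simp add: mult_left_mono)
  then have "(x + 1) powr x * (x + 1) \<le> x powr x * exp 1 * (x + 1)"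
    using assms by (intro mult_right_mono) auto
  then show ?thesis
    using assms by (simp add: powr_add mult_ac)
qed

text \<open>The Gamma recurrence moves by 1 while the arguments are multiples of
  \<open>1 / 2\<close>, hence two base cases.\<close>

lemma half_nat_induct [consumes 1, case_names half one step]:
  fixes P :: "real \<Rightarrow> bool"
  assumes "n \<ge> 1" "P (1 / 2)" "P 1" and step: "\<And>x. x \<ge> 1 / 2 \<Longrightarrow> P x \<Longrightarrow> P (x + 1)"
  shows "P (real n / 2)"
  using \<open>n \<ge> 1\<close>
proof (induction n rule: less_induct)
  case (less n)
  consider "n = 1" | "n = 2" | m where "n = m + 2" "m \<ge> 1"
    using less.prems le_Suc_ex[of 2 n] by (cases "n \<le> 2") (force simp: add.commute)+
  then show ?case
  proof cases
    case 3
    then have "P (real m / 2 + 1)"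
      by (intro step less.IH) auto
    then show ?thesis
      using 3 by (simp add: add_divide_distrib add.commute)
  qed (use assms in auto)
qed

lemma Gamma_three_halves: "Gamma (3 / 2 :: real) = sqrt pi / 2"
proof -
  have "(1 / 2 :: real) \<notin> \<int>\<^sub>\<le>\<^sub>0"
    using nonpos_Ints_nonpos[of "1 / 2 :: real"] by auto
  from Gamma_plus1[OF this] show ?thesis
    by (simp add: Gamma_one_half_real)
qed

lemma Gamma_plus1_pos: "(x :: real) > 0 \<Longrightarrow> Gamma (x + 1) = x * Gamma x"
  using nonpos_Ints_nonpos[of x] by (intro Gamma_plus1) auto

text \<open>A Stirling-type bound: from \<open>x\<close> to \<open>x + 1\<close> the left side grows
  by at most the factor \<open>exp 1 * (x + 1)\<close>, the right side by exactly that
  factor.\<close>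

lemma powr_self_le_exp_Gamma:
  assumes "n \<ge> 1"
  defines "x \<equiv> real n / 2"
  shows "x powr x \<le> exp x * Gamma (x + 1)"
  unfolding x_def using \<open>n \<ge> 1\<close>
proof (induction rule: half_nat_induct)
  case half
  have "sqrt 2 / 2 \<le> sqrt pi / 2"
    using pi_ge_two by simp
  also have "\<dots> \<le> exp (1 / 2) * (sqrt pi / 2)"
    by simp
  finally show ?case
    by (simp add: Gamma_three_halves powr_half_sqrt real_sqrt_divide real_div_sqrt field_simps)
next
  case one
  show ?case
    by (simp add: Gamma_numeral)
next
  case (step x)
  have "(x + 1) powr (x + 1) \<le> exp 1 * (x + 1) * x powr x"
    using step by (intro powr_self_step) auto
  also have "\<dots> \<le> exp 1 * (x + 1) * (exp x * Gamma (x + 1))"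
    using step by (intro mult_left_mono) auto
  also have "\<dots> = exp (x + 1) * Gamma (x + 1 + 1)"
    using step by (simp only: Gamma_plus1_pos exp_add) (simp add: mult_ac)
  finally show ?case .
qed

text \<open>The sine of \<open>pi / 6\<close> is \<open>1 / 2\<close> and is at most
  \<open>pi / 6\<close>.\<close>

lemma pi_ge_three: "pi \<ge> 3"
  using sin_x_le_x[of "pi / 6"] by (simp add: sin_30)

text \<open>This is the lower bound \<open>n powr (n / 2) / fact n\<close> for the volume of the
  unit ball, cleared of denominators. After cancelling \<open>2 * (x + 1)\<close>, the growth
  factors in the step compare as \<open>exp 1 * (x + 1)\<close> against
  \<open>pi * (2 * x + 1)\<close>, which holds because \<open>exp 1\<close> is at most 3 and
  \<open>pi\<close> at least 3.\<close>

lemma powr_mult_Gamma_le: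
  assumes "n \<ge> 1"
  defines "x \<equiv> real n / 2"
  shows "(2 * x) powr x * Gamma (x + 1) \<le> pi powr x * Gamma (2 * x + 1)"
  unfolding x_def using \<open>n \<ge> 1\<close>
proof (induction rule: half_nat_induct)
  case half
  show ?case
    by (simp add: Gamma_three_halves powr_half_sqrt Gamma_numeral)
next
  case one
  show ?case
    using pi_ge_two by (simp add: Gamma_numeral)
next
  case (step x)
  have G1: "Gamma (x + 1 + 1) = (x + 1) * Gamma (x + 1)"
    using step by (intro Gamma_plus1_pos) auto
  have G2: "Gamma (2 * x + 1 + 1) = (2 * x + 1) * Gamma (2 * x + 1)"
    using step by (intro Gamma_plus1_pos) auto
  have G3: "Gamma (2 * x + 1 + 1 + 1) = (2 * x + 1 + 1) * Gamma (2 * x + 1 + 1)"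
    using step by (intro Gamma_plus1_pos) auto
  have "exp 1 * (x + 1) \<le> 3 * (x + 1)"
    using step exp_le by (intro mult_right_mono) auto
  also have "\<dots> \<le> 3 * (2 * x + 1)"
    using step by simp
  also have "\<dots> \<le> pi * (2 * x + 1)"
    using step pi_ge_three by (intro mult_right_mono) auto
  finally have e: "exp 1 * (x + 1) \<le> pi * (2 * x + 1)" .
  have "(2 * (x + 1)) powr (x + 1) * Gamma (x + 1 + 1)
      = 2 powr (x + 1) * (x + 1) powr (x + 1) * ((x + 1) * Gamma (x + 1))"
    using step by (simp only: G1 powr_mult)
  also have "\<dots> \<le> 2 powr (x + 1) * (exp 1 * (x + 1) * x powr x) * ((x + 1) * Gamma (x + 1))"
    using step by (intro mult_right_mono mult_left_mono powr_self_step) auto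
  also have "\<dots> = 2 * (x + 1) * (exp 1 * (x + 1)) * ((2 * x) powr x * Gamma (x + 1))"
    using step by (simp add: powr_add powr_mult mult_ac)
  also have "\<dots> \<le> 2 * (x + 1) * (pi * (2 * x + 1)) * (pi powr x * Gamma (2 * x + 1))"
    using step.hyps by (intro mult_mono[OF mult_left_mono[OF e] step.IH]) auto
  also have "\<dots> = pi powr (x + 1) * Gamma (2 * x + 1 + 1 + 1)"
    unfolding G3 G2 by (simp add: powr_add algebra_simps)
  also have "2 * x + 1 + 1 + 1 = 2 * (x + 1) + 1"
    by simp
  finally show ?case .
qed

lemma unit_ball_vol_le:
  assumes "n \<ge> 1"
  shows "unit_ball_vol (real n) \<le> (2 * pi * exp 1 / real n) powr (real n / 2)"
proof -
  let ?x = "real n / 2"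
  have x: "?x > 0" "Gamma (?x + 1) > 0"
    using assms by auto
  have "pi powr ?x * ?x powr ?x \<le> pi powr ?x * (exp ?x * Gamma (?x + 1))"
    using powr_self_le_exp_Gamma[OF assms] by (intro mult_left_mono) auto
  then have "pi powr ?x / Gamma (?x + 1) \<le> pi powr ?x * exp ?x / ?x powr ?x"
    using x by (simp add: field_simps)
  also have "exp ?x = exp 1 powr ?x"
    by (simp add: powr_def)
  also have "pi powr ?x * exp 1 powr ?x / ?x powr ?x = (pi * exp 1 / ?x) powr ?x"
    using x by (simp add: powr_mult powr_divide)
  also have "pi * exp 1 / ?x = 2 * pi * exp 1 / real n"
    by simp
  finally show ?thesis
    by (simp add: unit_ball_vol_def)
qed

text \<open>Squared so as to trade the \<open>(fact n)\<^sup>2\<close> of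
  \<open>measure_convex_hull_le\<close> for the square of the ball volume.\<close>

lemma unit_ball_vol_square_ge:
  assumes "n \<ge> 1"
  shows "real n ^ n / (fact n)\<^sup>2 \<le> (unit_ball_vol (real n))\<^sup>2"
proof -
  let ?x = "real n / 2"
  have x: "?x > 0" "Gamma (?x + 1) > 0"
    using assms by auto
  have "real n powr ?x * Gamma (?x + 1) \<le> pi powr ?x * fact n"
    using powr_mult_Gamma_le[OF assms] Gamma_fact[of n, where 'a = real] by (simp add: add.commute)
  then have "real n powr ?x / fact n \<le> unit_ball_vol (real n)"
    using x by (simp add: unit_ball_vol_def field_simps)
  then have "(real n powr ?x / fact n)\<^sup>2 \<le> (unit_ball_vol (real n))\<^sup>2"
    by (intro power_mono) auto
  moreover have "(real n powr ?x)\<^sup>2 = real n ^ n"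
    using assms by (simp add: power2_eq_square flip: powr_add powr_realpow)
  ultimately show ?thesis
    by (simp add: power_divide)
qed

section \<open>Ellipsoids and the vertex index\<close>

lemma zero_in_interior:
  fixes K :: "(real ^ 'n) set"
  assumes "convex_body K" and "zero_symmetric K"
  shows "0 \<in> interior K"
proof -
  obtain x where x: "x \<in> interior K"
    using assms by (auto simp: convex_body_def)
  have "uminus ` interior K = interior K"
    using assms(2) interior_negations[of K] by (simp add: zero_symmetric_def)
  then have "- x \<in> interior K"
    using x by blast
  moreover have "convex (interior K)"
    using assms by (auto simp: convex_body_def)
  ultimately have "(1 / 2) *\<^sub>R x + (1 / 2) *\<^sub>R (- x) \<in> interior K"
    using x by (intro convexD) auto
  then show ?thesis
    by simp
qed

text \<open>If \<open>x = l *\<^sub>R y\<close> with \<open>y\<close> in \<open>K\<close>, then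
  \<open>g x\<close> has norm at most \<open>l\<close>. It will be applied to the inverse of the map
  defining an ellipsoid around \<open>K\<close>.\<close>

lemma norm_linear_le_body_norm:
  fixes g :: "real ^ 'n \<Rightarrow> real ^ 'n"
  assumes g: "linear g" "g ` K \<subseteq> cball 0 1" and 0: "0 \<in> interior K"
  shows "norm (g x) \<le> body_norm K x"
  unfolding body_norm_def
proof (rule cInf_greatest)
  obtain e where e: "e > 0" "cball 0 e \<subseteq> K"
    using 0 by (auto simp: mem_interior_cball)
  \<comment> \<open>An admissible scaling factor, so that the infimum is over a nonempty set; the
    summand 1 keeps it positive at \<open>x = 0\<close>.\<close>
  define l where "l = norm x / e + 1"
  have l: "l > 0" "norm x \<le> e * l"
    using e by (auto simp: l_def field_simps add_pos_nonneg)
  then have "(1 / l) *\<^sub>R x \<in> K"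
    using e by (intro subsetD[OF e(2)]) (simp add: field_simps)
  moreover have "x = l *\<^sub>R (1 / l) *\<^sub>R x"
    using l by simp
  ultimately show "{l. l > 0 \<and> x \<in> (*\<^sub>R) l ` K} \<noteq> {}"
    using l(1) by blast
next
  fix l
  assume "l \<in> {l. l > 0 \<and> x \<in> (*\<^sub>R) l ` K}"
  then obtain y where y: "l > 0" "y \<in> K" "x = l *\<^sub>R y"
    by blast
  then have "norm (g y) \<le> 1"
    using g(2) by auto
  then show "norm (g x) \<le> l"
    using y g(1) by (simp add: linear_scale)
qed

text \<open>A large ball shows that the infimum in \<open>ovr\<close> is over a nonempty set,
  without which it could not be bounded below.\<close>

lemma ellipsoid_superset_exists:
  fixes K :: "(real ^ 'n) set"
  assumes "bounded K"
  obtains E where "zero_symmetric_ellipsoid E" "K \<subseteq> E"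
proof -
  obtain R where R: "R > 0" "K \<subseteq> cball 0 R"
    using assms unfolding bounded_pos by (metis mem_cball_0 subsetI)
  have "bij ((*\<^sub>R) R :: real ^ 'n \<Rightarrow> real ^ 'n)"
    using R by (intro bij_betw_byWitness[where f' = "(*\<^sub>R) (1 / R)"]) auto
  moreover have "cball 0 R = (*\<^sub>R) R ` cball (0 :: real ^ 'n) 1"
    using R cball_scale[of R "0 :: real ^ 'n" 1] by simp
  ultimately have "zero_symmetric_ellipsoid (cball (0 :: real ^ 'n) R)"
    unfolding zero_symmetric_ellipsoid_def using linear_scaleR by blast
  with R show ?thesis
    using that by blast
qed

text \<open>The same nonemptiness for \<open>vein\<close>: a bounding box is the hull of a finite
  set, which is then enumerated as a family.\<close>

lemma finite_hull_superset_exists: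
  fixes K :: "(real ^ 'n) set"
  assumes "bounded K"
  obtains m :: nat and p :: "nat \<Rightarrow> real ^ 'n" where "K \<subseteq> convex hull (p ` {..<m})"
proof -
  obtain a b where ab: "K \<subseteq> cbox a b"
    using assms bounded_subset_cbox_symmetric by metis
  obtain S where S: "finite S" "cbox a b = convex hull S"
    using closed_interval_as_convex_hull by blast
  obtain m and p :: "nat \<Rightarrow> real ^ 'n" where "S = p ` {i. i < m}"
    using finite_imp_nat_seg_image_inj_on[OF S(1)] by blast
  then show ?thesis
    using that[of p m] ab S(2) by (simp add: lessThan_def)
qed

text \<open>Together these make every ratio \<open>vol E / vol K\<close> at least 1, which later
  keeps \<open>ovr K\<close> away from zero.\<close>

lemma
  fixes K :: "(real ^ 'n) set"
  assumes "convex_body K" and E: "zero_symmetric_ellipsoid E" and "K \<subseteq> E"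
  shows measure_convex_body_pos: "vol K > 0"
    and measure_convex_body_le_ellipsoid: "vol K \<le> vol E"
proof -
  have K: "K \<in> lmeasurable"
    using assms by (auto simp: convex_body_def lmeasurable_compact)
  have "\<not> negligible K"
    using assms by (simp add: convex_body_def negligible_convex_interior)
  then show "vol K > 0"
    using K by (simp add: negligible_iff_measure zero_less_measure_iff measure_eq_0_null_sets)
  obtain f :: "real ^ 'n \<Rightarrow> real ^ 'n" where "linear f" "E = f ` cball 0 1"
    using E unfolding zero_symmetric_ellipsoid_def by blast
  then have "E \<in> lmeasurable"
    by (simp add: lmeasurable_linear_image_cart lmeasurable_compact)
  then show "vol K \<le> vol E"
    using K \<open>K \<subseteq> E\<close> by (intro measure_mono_fmeasurable) (auto dest: fmeasurableD)
qed

lemma vol_unit_cball: "vol (cball (0 :: real ^ 'n) 1) = unit_ball_vol (real CARD('n))"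
proof -
  have "vol (cball (0 :: real ^ 'n) 1) = measure lborel (cball (0 :: real ^ 'n) 1)"
    by (rule measure_completion) simp
  then show ?thesis
    by (simp add: content_cball)
qed

text \<open>The right-hand inequality for one ellipsoid and one family, before taking roots. Pulling
  back by \<open>f\<close> turns \<open>E\<close> into the unit ball and leaves
  \<open>vol E / vol K\<close> unchanged, since both volumes scale by \<open>D\<close>.\<close>

lemma vertex_sum_ellipsoid_bound:
  fixes K :: "(real ^ 'n) set"
  assumes K: "convex_body K" "zero_symmetric K"
    and E: "zero_symmetric_ellipsoid E" "K \<subseteq> E"
    and p: "K \<subseteq> convex hull (p ` {..<m :: nat})"
  defines "S \<equiv> \<Sum>i<m. body_norm K (p i)"
  shows "S \<ge> 0" and "real CARD('n) ^ CARD('n) \<le> vol E / vol K * vol (cball (0 :: real ^ 'n) 1) * S ^ CARD('n)"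
proof -
  let ?n = "CARD('n)"
  let ?B = "cball (0 :: real ^ 'n) 1"
  obtain f where f: "linear f" "bij f" "E = f ` ?B"
    using E(1) by (auto simp: zero_symmetric_ellipsoid_def)
  define g where "g = inv f"
  have g: "linear g"
    unfolding g_def using f bij_is_inj bij_is_surj by (intro inj_linear_imp_inv_linear) auto
  have fg: "f (g x) = x" and gf: "g (f x) = x" for x
    using f(2) by (simp_all add: g_def bij_is_surj surj_f_inv_f bij_is_inj inv_f_f)
  have gK: "g ` K \<subseteq> ?B"
  proof -
    have "g ` K \<subseteq> g ` f ` ?B"
      using E(2) f(3) by blast
    then show ?thesis
      by (simp add: image_image gf)
  qed
  have le: "norm (g x) \<le> body_norm K x" for x
    using norm_linear_le_body_norm[OF g gK zero_in_interior[OF K]] .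
  then show S0: "S \<ge> 0"
    unfolding S_def by (intro sum_nonneg) (meson norm_ge_zero order_trans)
  have Km: "K \<in> lmeasurable"
    using K(1) by (auto simp: convex_body_def lmeasurable_compact)
  have gKm: "g ` K \<in> lmeasurable"
    using g Km by (rule lmeasurable_linear_image_cart)
  define D where "D = \<bar>det (matrix f)\<bar>"
  have D: "D > 0"
    using det_nz_iff_inj[OF f(1)] f(2) by (simp add: D_def bij_is_inj)
  have "f ` g ` K = K"
    by (simp add: image_image fg)
  then have volK: "vol K = D * vol (g ` K)"
    using measure_linear_image_cart[OF f(1) gKm] by (simp add: D_def)
  have volE: "vol E = D * vol ?B"
    unfolding f(3) D_def using f(1) by (intro measure_linear_image_cart) (auto intro: lmeasurable_compact)
  let ?Q = "g ` p ` {..<m}"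
  have "g ` K \<subseteq> convex hull ?Q"
    using image_mono[OF p, of g] by (simp add: convex_hull_linear_image[OF g])
  then have "vol (g ` K) \<le> vol (convex hull ?Q)"
    using gKm by (intro measure_mono_fmeasurable)
      (auto intro!: lmeasurable_compact finite_imp_compact_convex_hull dest: fmeasurableD)
  also have "\<dots> \<le> (\<Sum>v\<in>?Q. norm v) ^ ?n / (fact ?n)\<^sup>2"
    by (intro measure_convex_hull_le) auto
  also have "(\<Sum>v\<in>?Q. norm v) \<le> S"
  proof -
    \<comment> \<open>Repeated points are counted once in the set \<open>?Q\<close> but each time in
      the family, so passing to the family can only increase the sum.\<close>
    have "(\<Sum>v\<in>?Q. norm v) \<le> (\<Sum>i<m. norm (g (p i)))"
      using sum_image_le[of "{..<m}" norm "\<lambda>i. g (p i)"] by (simp add: image_image o_def)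
    also have "\<dots> \<le> S"
      unfolding S_def by (intro sum_mono le)
    finally show ?thesis .
  qed
  then have "(\<Sum>v\<in>?Q. norm v) ^ ?n / (fact ?n)\<^sup>2 \<le> S ^ ?n / (fact ?n)\<^sup>2"
    by (intro divide_right_mono power_mono sum_nonneg) auto
  finally have "vol (g ` K) * real ?n ^ ?n \<le> S ^ ?n / (fact ?n)\<^sup>2 * real ?n ^ ?n"
    by (intro mult_right_mono) auto
  also have "\<dots> = S ^ ?n * (real ?n ^ ?n / (fact ?n)\<^sup>2)"
    by simp
  also have "\<dots> \<le> S ^ ?n * (vol ?B)\<^sup>2"
    unfolding vol_unit_cball using S0 by (intro mult_left_mono unit_ball_vol_square_ge) auto
  finally have "vol (g ` K) * real ?n ^ ?n \<le> S ^ ?n * (vol ?B)\<^sup>2" .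
  moreover have "vol (g ` K) > 0"
    using volK D measure_convex_body_pos[OF K(1) E] by (simp add: zero_less_mult_iff)
  ultimately show "real ?n ^ ?n \<le> vol E / vol K * vol ?B * S ^ ?n"
    using D unfolding volK volE by (simp add: field_simps power2_eq_square)
qed

theorem theorem5p2:
  fixes K :: "(real ^ 'n) set" and d :: nat
  assumes "d = CARD('n)" and "d \<ge> 2"
    and "convex_body K" and "zero_symmetric K"
  shows "real d powr (3 / 2) / (sqrt (2 * pi * exp 1) * ovr K)
           \<le> real d / (vol (cball (0 :: real ^ 'n) 1) powr (1 / real d) * ovr K)
       \<and> real d / (vol (cball (0 :: real ^ 'n) 1) powr (1 / real d) * ovr K) \<le> vein K"
proof -
  define v where "v = vol (cball (0 :: real ^ 'n) 1) powr (1 / real d)"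
  define r where "r E = (vol E / vol K) powr (1 / real d)" for E :: "(real ^ 'n) set"
  define \<E> where "\<E> = {E. zero_symmetric_ellipsoid E \<and> K \<subseteq> E}"
  have vB: "vol (cball (0 :: real ^ 'n) 1) > 0"
    by (simp add: vol_unit_cball)
  then have v: "v > 0"
    by (simp add: v_def)
  have d: "real d > 0"
    using assms by simp
  have bdd: "bounded K"
    using assms by (simp add: convex_body_def compact_imp_bounded)
  have ovr: "ovr K = Inf (r ` \<E>)"
    unfolding ovr_def r_def \<E>_def assms(1) by (intro arg_cong[of _ _ Inf]) auto
  have ne: "r ` \<E> \<noteq> {}"
    using ellipsoid_superset_exists[OF bdd] by (auto simp: \<E>_def)
  have "1 \<le> r E" if "E \<in> \<E>" for E
    using measure_convex_body_pos[of K E] measure_convex_body_le_ellipsoid[of K E] that assms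
    by (auto simp: r_def \<E>_def intro!: ge_one_powr_ge_zero)
  then have ovr1: "ovr K \<ge> 1"
    unfolding ovr using ne by (intro cInf_greatest) auto
  \<comment> \<open>The family is fixed first, and the infimum over ellipsoids is taken for that
    fixed sum \<open>s\<close>.\<close>
  have "real d / (v * ovr K) \<le> vein K"
    unfolding vein_def
  proof (rule cInf_greatest)
    obtain m and p :: "nat \<Rightarrow> real ^ 'n" where "K \<subseteq> convex hull (p ` {..<m})"
      using finite_hull_superset_exists[OF bdd] .
    then show "{(\<Sum>i<m. body_norm K (p i)) | (m :: nat) (p :: nat \<Rightarrow> real ^ 'n).
        K \<subseteq> convex hull (p ` {..<m})} \<noteq> {}"
      by blast
  next
    fix s
    assume "s \<in> {(\<Sum>i<m. body_norm K (p i)) | (m :: nat) (p :: nat \<Rightarrow> real ^ 'n).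
        K \<subseteq> convex hull (p ` {..<m})}"
    then obtain m :: nat and p :: "nat \<Rightarrow> real ^ 'n" where p: "K \<subseteq> convex hull (p ` {..<m})" and s: "s = (\<Sum>i<m. body_norm K (p i))"
      by blast
    have key: "s \<ge> 0" "real d \<le> r E * v * s" if "E \<in> \<E>" for E
    proof -
      have E: "zero_symmetric_ellipsoid E" "K \<subseteq> E"
        using that by (auto simp: \<E>_def)
      note bound = vertex_sum_ellipsoid_bound[OF assms(3,4) E p, folded s assms(1)]
      show "s \<ge> 0"
        by (rule bound)
      have "real d = (real d ^ d) powr (1 / real d)"
        using d by (simp add: powr_powr flip: powr_realpow)
      also have "\<dots> \<le> (vol E / vol K * vol (cball (0 :: real ^ 'n) 1) * s ^ d) powr (1 / real d)"
        using bound(2) by (intro powr_mono2) auto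
      also have "\<dots> = r E * v * (s ^ d) powr (1 / real d)"
        using bound(1) by (simp add: powr_mult r_def v_def del: times_divide_eq_left)
      \<comment> \<open>The case \<open>s = 0\<close> is separate because converting between
        \<open>powr\<close> and powers needs a positive base.\<close>
      also have "(s ^ d) powr (1 / real d) = s"
        using bound(1) d by (cases "s = 0") (auto simp: powr_powr power_0_left simp flip: powr_realpow)
      finally show "real d \<le> r E * v * s" .
    qed
    obtain E where "E \<in> \<E>"
      using ne by blast
    \<comment> \<open>With \<open>s = 0\<close> the bound would read \<open>real d \<le> 0\<close>;
      positivity permits dividing by \<open>v * s\<close>.\<close>
    from key[OF this] d have "s > 0"
      by (cases "s = 0") auto
    have "real d / (v * s) \<le> ovr K"
      unfolding ovr
    proof (rule cInf_greatest[OF ne])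
      fix y
      assume "y \<in> r ` \<E>"
      then show "real d / (v * s) \<le> y"
        using key(2) v \<open>s > 0\<close> by (auto simp: field_simps)
    qed
    then show "real d / (v * ovr K) \<le> s"
      using v \<open>s > 0\<close> ovr1 by (simp add: field_simps)
  qed
  moreover have "real d powr (3 / 2) / (sqrt (2 * pi * exp 1) * ovr K) \<le> real d / (v * ovr K)"
  proof -
    \<comment> \<open>The root of order \<open>d\<close> turns the exponent
      \<open>real d / 2\<close> into \<open>1 / 2\<close>, giving the square roots of the left-hand
      inequality.\<close>
    have "v \<le> ((2 * pi * exp 1 / real d) powr (real d / 2)) powr (1 / real d)"
      unfolding v_def vol_unit_cball assms(1) [symmetric]
      using assms(2) by (intro powr_mono2 unit_ball_vol_le) auto
    also have "\<dots> = sqrt (2 * pi * exp 1) / sqrt (real d)"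
      using d by (simp add: powr_powr powr_half_sqrt real_sqrt_divide)
    finally have "v * sqrt (real d) \<le> sqrt (2 * pi * exp 1)"
      using d by (simp add: field_simps)
    then have "real d * (v * sqrt (real d)) \<le> real d * sqrt (2 * pi * exp 1)"
      by (intro mult_left_mono) auto
    moreover have "real d powr (3 / 2) = real d * sqrt (real d)"
      using d powr_add[of "real d" 1 "1 / 2"] by (simp add: powr_half_sqrt)
    ultimately have "real d powr (3 / 2) / sqrt (2 * pi * exp 1) \<le> real d / v"
      using v by (simp add: field_simps)
    then have "real d powr (3 / 2) / sqrt (2 * pi * exp 1) / ovr K \<le> real d / v / ovr K"
      using ovr1 by (intro divide_right_mono) auto
    then show ?thesis
      by simp
  qed
  ultimately show ?thesis
    by (simp add: v_def)
qed

end
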